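(* Let $m$ be a measure on a pseudo-BCK algebra $A$. Then $A/\mathrm{Ker}_0(m)$ is a pseudo-BCK algebra, the mapping $\hat m:A/\mathrm{Ker}_0(m)\to[0,+\infty)$ defined by $\hat m(x/\mathrm{Ker}_0(m)):=m(x)$ is a well-defined measure on $A/\mathrm{Ker}_0(m)$, and $A/\mathrm{Ker}_0(m)$ is $\vee$-commutative (i.e., both $\vee_1$-commutative and $\vee_2$-commutative).
   Context: A pseudo-BCK algebra is a structure $(A,\le,\rightarrow,\rightsquigarrow,1)$ with $\le$ a binary relation, $\rightarrow,\rightsquigarrow$ binary operations and $1\in A$, such that for all $x,y,z\in A$: $x\rightarrow y\le (y\rightarrow z)\rightsquigarrow(x\rightarrow z)$ and $x\rightsquigarrow y\le (y\rightsquigarrow z)\rightarrow(x\rightsquigarrow z)$; $x\le (x\rightarrow y)\rightsquigarrow y$ and $x\le (x\rightsquigarrow y)\rightarrow y$; $x\le x$; $x\le 1$; antisymmetry of $\le$; $x\le y$ iff $x\rightarrow y=1$ iff $x\rightsquigarrow y=1$. Set $x\vee_1 y=(x\rightarrow y)\rightsquigarrow y$, $x\vee_2 y=(x\rightsquigarrow y)\rightarrow y$; $A$ is $\vee_i$-commutative if $x\vee_i y=y\vee_i x$ for all $x,y$. A measure on $A$ is a map $m:A\to[0,\infty)$ with $m(x\rightarrow y)=m(x\rightsquigarrow y)=m(y)-m(x)$ whenever $y\le x$; $\mathrm{Ker}_0(m)=\{x\in A: m(x)=0\}$ (a normal filter). A filter is a set $F\ni 1$ with $a,a\rightarrow b\in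 F\Rightarrow b\in F$; normal if $a\rightarrow b\in F\iff a\rightsquigarrow b\in F$; for a normal filter $F$, $A/F$ is the quotient by the congruence $a\Theta_F b\iff a\rightarrow b, b\rightarrow a\in F$. *)

theory Defs
  imports Complex_Main "HOL-Algebra.Congruence"
begin

record 'a psbck = "'a partial_object" +
  leq :: "'a \<Rightarrow> 'a \<Rightarrow> bool" (infixl \<open>\<preceq>\<index>\<close> 50)
  arr :: "'a \<Rightarrow> 'a \<Rightarrow> 'a" (infixr \<open>\<rightarrow>\<index>\<close> 60)
  sqarr :: "'a \<Rightarrow> 'a \<Rightarrow> 'a" (infixr \<open>\<leadsto>\<index>\<close> 60)
  unity :: 'a (\<open>\<one>\<index>\<close>)

locale pseudo_bck =
  fixes A :: "('a, 'b) psbck_scheme"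
  assumes unity_closed: "\<one>\<^bsub>A\<^esub> \<in> carrier A"
    and arr_closed: "\<lbrakk>x \<in> carrier A; y \<in> carrier A\<rbrakk> \<Longrightarrow> x \<rightarrow>\<^bsub>A\<^esub> y \<in> carrier A"
    and sqarr_closed: "\<lbrakk>x \<in> carrier A; y \<in> carrier A\<rbrakk> \<Longrightarrow> x \<leadsto>\<^bsub>A\<^esub> y \<in> carrier A"
    and arr_trans: "\<lbrakk>x \<in> carrier A; y \<in> carrier A; z \<in> carrier A\<rbrakk> \<Longrightarrow>
      (x \<rightarrow>\<^bsub>A\<^esub> y) \<preceq>\<^bsub>A\<^esub> ((y \<rightarrow>\<^bsub>A\<^esub> z) \<leadsto>\<^bsub>A\<^esub> (x \<rightarrow>\<^bsub>A\<^esub> z))"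
    and sqarr_trans: "\<lbrakk>x \<in> carrier A; y \<in> carrier A; z \<in> carrier A\<rbrakk> \<Longrightarrow>
      (x \<leadsto>\<^bsub>A\<^esub> y) \<preceq>\<^bsub>A\<^esub> ((y \<leadsto>\<^bsub>A\<^esub> z) \<rightarrow>\<^bsub>A\<^esub> (x \<leadsto>\<^bsub>A\<^esub> z))"
    and le_arr_sqarr: "\<lbrakk>x \<in> carrier A; y \<in> carrier A\<rbrakk> \<Longrightarrow>
      x \<preceq>\<^bsub>A\<^esub> ((x \<rightarrow>\<^bsub>A\<^esub> y) \<leadsto>\<^bsub>A\<^esub> y)"
    and le_sqarr_arr: "\<lbrakk>x \<in> carrier A; y \<in> carrier A\<rbrakk> \<Longrightarrow>
      x \<preceq>\<^bsub>A\<^esub> ((x \<leadsto>\<^bsub>A\<^esub> y) \<rightarrow>\<^bsub>A\<^esub> y)"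
    and le_refl: "x \<in> carrier A \<Longrightarrow> x \<preceq>\<^bsub>A\<^esub> x"
    and le_unity: "x \<in> carrier A \<Longrightarrow> x \<preceq>\<^bsub>A\<^esub> \<one>\<^bsub>A\<^esub>"
    and le_antisym: "\<lbrakk>x \<in> carrier A; y \<in> carrier A; x \<preceq>\<^bsub>A\<^esub> y; y \<preceq>\<^bsub>A\<^esub> x\<rbrakk> \<Longrightarrow> x = y"
    and le_iff_arr: "\<lbrakk>x \<in> carrier A; y \<in> carrier A\<rbrakk> \<Longrightarrow>
      x \<preceq>\<^bsub>A\<^esub> y \<longleftrightarrow> x \<rightarrow>\<^bsub>A\<^esub> y = \<one>\<^bsub>A\<^esub>"
    and le_iff_sqarr: "\<lbrakk>x \<in> carrier A; y \<in> carrier A\<rbrakk> \<Longrightarrow>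
      x \<preceq>\<^bsub>A\<^esub> y \<longleftrightarrow> x \<leadsto>\<^bsub>A\<^esub> y = \<one>\<^bsub>A\<^esub>"

definition vee1 :: "('a, 'b) psbck_scheme \<Rightarrow> 'a \<Rightarrow> 'a \<Rightarrow> 'a" where
  "vee1 A x y = (x \<rightarrow>\<^bsub>A\<^esub> y) \<leadsto>\<^bsub>A\<^esub> y"

definition vee2 :: "('a, 'b) psbck_scheme \<Rightarrow> 'a \<Rightarrow> 'a \<Rightarrow> 'a" where
  "vee2 A x y = (x \<leadsto>\<^bsub>A\<^esub> y) \<rightarrow>\<^bsub>A\<^esub> y"

definition vee1_commutative :: "('a, 'b) psbck_scheme \<Rightarrow> bool" where
  "vee1_commutative A \<longleftrightarrow> (\<forall>x\<in>carrier A. \<forall>y\<in>carrier A. vee1 A x y = vee1 A y x)"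

definition vee2_commutative :: "('a, 'b) psbck_scheme \<Rightarrow> bool" where
  "vee2_commutative A \<longleftrightarrow> (\<forall>x\<in>carrier A. \<forall>y\<in>carrier A. vee2 A x y = vee2 A y x)"

definition bck_measure :: "('a, 'b) psbck_scheme \<Rightarrow> ('a \<Rightarrow> real) \<Rightarrow> bool" where
  "bck_measure A m \<longleftrightarrow>
    (\<forall>x\<in>carrier A. 0 \<le> m x) \<and>
    (\<forall>x\<in>carrier A. \<forall>y\<in>carrier A. y \<preceq>\<^bsub>A\<^esub> x \<longrightarrow>
      m (x \<rightarrow>\<^bsub>A\<^esub> y) = m y - m x \<and> m (x \<leadsto>\<^bsub>A\<^esub> y) = m y - m x)"

definition ker0 :: "('a, 'b) psbck_scheme \<Rightarrow> ('a \<Rightarrow> real) \<Rightarrow> 'a set" where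
  "ker0 A m = {x \<in> carrier A. m x = 0}"

definition bck_filter :: "('a, 'b) psbck_scheme \<Rightarrow> 'a set \<Rightarrow> bool" where
  "bck_filter A F \<longleftrightarrow> F \<subseteq> carrier A \<and> \<one>\<^bsub>A\<^esub> \<in> F \<and>
    (\<forall>a\<in>carrier A. \<forall>b\<in>carrier A. a \<in> F \<longrightarrow> a \<rightarrow>\<^bsub>A\<^esub> b \<in> F \<longrightarrow> b \<in> F)"

definition normal_filter :: "('a, 'b) psbck_scheme \<Rightarrow> 'a set \<Rightarrow> bool" where
  "normal_filter A F \<longleftrightarrow> bck_filter A F \<and>
    (\<forall>a\<in>carrier A. \<forall>b\<in>carrier A. a \<rightarrow>\<^bsub>A\<^esub> b \<in> F \<longleftrightarrow> a \<leadsto>\<^bsub>A\<^esub> b \<in> F)"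

definition bck_congruence :: "('a, 'b) psbck_scheme \<Rightarrow> ('a \<times> 'a) set \<Rightarrow> bool" where
  "bck_congruence A r \<longleftrightarrow> equiv (carrier A) r \<and>
    (\<forall>a b c d. (a, b) \<in> r \<longrightarrow> (c, d) \<in> r \<longrightarrow>
      (a \<rightarrow>\<^bsub>A\<^esub> c, b \<rightarrow>\<^bsub>A\<^esub> d) \<in> r \<and> (a \<leadsto>\<^bsub>A\<^esub> c, b \<leadsto>\<^bsub>A\<^esub> d) \<in> r)"

definition theta :: "('a, 'b) psbck_scheme \<Rightarrow> 'a set \<Rightarrow> ('a \<times> 'a) set" where
  "theta A F = {(a, b). a \<in> carrier A \<and> b \<in> carrier A \<and> a \<rightarrow>\<^bsub>A\<^esub> b \<in> F \<and> b \<rightarrow>\<^bsub>A\<^esub> a \<in> F}"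

definition cls :: "('a, 'b) psbck_scheme \<Rightarrow> 'a set \<Rightarrow> 'a \<Rightarrow> 'a set" where
  "cls A F x = theta A F `` {x}"

text \<open>The operations on classes are written as unions over all representatives, in the style of
  \<^theory>\<open>HOL.Equiv_Relations\<close>; if \<^const>\<open>theta\<close> is a congruence, the union is a single class.
  The order of the quotient is x/F \<open>\<le>\<close> y/F iff x \<open>\<rightarrow>\<close> y is in F.\<close>

definition quot :: "('a, 'b) psbck_scheme \<Rightarrow> 'a set \<Rightarrow> 'a set psbck" where
  "quot A F = \<lparr>
    carrier = carrier A // theta A F,
    leq = (\<lambda>X Y. \<exists>x\<in>X. \<exists>y\<in>Y. x \<rightarrow>\<^bsub>A\<^esub> y \<in> F),
    arr = (\<lambda>X Y. \<Union>x\<in>X. \<Union>y\<in>Y. cls A F (x \<rightarrow>\<^bsub>A\<^esub> y)),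
    sqarr = (\<lambda>X Y. \<Union>x\<in>X. \<Union>y\<in>Y. cls A F (x \<leadsto>\<^bsub>A\<^esub> y)),
    unity = cls A F \<one>\<^bsub>A\<^esub>\<rparr>"

text \<open>Meaningful when \<open>m\<close> is constant on the class \<open>X\<close>; otherwise the value is unspecified.\<close>

definition quot_measure :: "('a \<Rightarrow> real) \<Rightarrow> 'a set \<Rightarrow> real" where
  "quot_measure m X = the_elem (m ` X)"

end

theory Submission
  imports Defs
begin

text \<open>The identity \<open>(x \<or>\<^sub>1 y) \<rightarrow> y = x \<rightarrow> y\<close> gives \<open>m (x \<rightarrow> y) = m y - m (x \<or>\<^sub>1 y)\<close>, which reduces every
  question about \<open>m\<close> to the values \<open>m (x \<or>\<^sub>1 y)\<close>. If \<open>y \<le> z\<close>, then \<open>z \<or>\<^sub>1 y\<close> lies above \<open>z\<close> but has the same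
  measure; together with monotonicity of \<open>\<or>\<^sub>1\<close> in its first argument this shows that \<open>m (x \<or>\<^sub>1 y)\<close>
  is symmetric in \<open>x, y\<close> and equals \<open>m (x \<or>\<^sub>2 y)\<close>. Normality of the kernel follows, and so does the
  measure property of the quotient. There, comparable elements of equal measure coincide, and the
  same comparison of \<open>z \<or>\<^sub>1 y\<close> with \<open>z\<close> yields commutativity. The statements about \<open>\<or>\<^sub>2\<close> are
  obtained by exchanging the two arrows.\<close>

unbundle no funcset_syntax

section \<open>Exchanging the two arrows\<close>

definition dual :: "('a, 'b) psbck_scheme \<Rightarrow> ('a, 'b) psbck_scheme" where
  "dual A = A\<lparr>arr := sqarr A, sqarr := arr A\<rparr>"

lemma dual_simps [simp]:
  "carrier (dual A) = carrier A" "leq (dual A) = leq A" "arr (dual A) = sqarr A"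
  "sqarr (dual A) = arr A" "unity (dual A) = unity A"
  by (simp_all add: dual_def)

lemma vee_dual [simp]: "vee1 (dual A) = vee2 A" "vee2 (dual A) = vee1 A"
  by (simp_all add: fun_eq_iff vee1_def vee2_def)

lemma bck_measure_dual [simp]: "bck_measure (dual A) m = bck_measure A m"
  by (auto simp: bck_measure_def)

lemma pseudo_bck_dual:
  assumes "pseudo_bck A"
  shows "pseudo_bck (dual A)"
proof -
  interpret pseudo_bck A by fact
  show ?thesis
    by unfold_locales
      (auto intro: unity_closed arr_closed sqarr_closed arr_trans sqarr_trans le_arr_sqarr
        le_sqarr_arr le_refl le_unity le_antisym simp: le_iff_arr[symmetric] le_iff_sqarr[symmetric])
qed

section \<open>Arithmetic of pseudo-BCK algebras\<close>

locale psbck = pseudo_bck A for A (structure)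
begin

lemmas closed [simp, intro] = unity_closed arr_closed sqarr_closed

lemma vee1_closed [simp, intro]:
  "x \<in> carrier A \<Longrightarrow> y \<in> carrier A \<Longrightarrow> vee1 A x y \<in> carrier A"
  by (simp add: vee1_def)

lemma vee2_closed [simp, intro]:
  "x \<in> carrier A \<Longrightarrow> y \<in> carrier A \<Longrightarrow> vee2 A x y \<in> carrier A"
  by (simp add: vee2_def)

lemma unity_arr [simp]: "x \<in> carrier A \<Longrightarrow> \<one> \<rightarrow> x = x"
  and unity_sqarr [simp]: "x \<in> carrier A \<Longrightarrow> \<one> \<leadsto> x = x"
  and arr_unity [simp]: "x \<in> carrier A \<Longrightarrow> x \<rightarrow> \<one> = \<one>"
  and sqarr_unity [simp]: "x \<in> carrier A \<Longrightarrow> x \<leadsto> \<one> = \<one>"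
  and arr_self [simp]: "x \<in> carrier A \<Longrightarrow> x \<rightarrow> x = \<one>"
  and sqarr_self [simp]: "x \<in> carrier A \<Longrightarrow> x \<leadsto> x = \<one>"
proof -
  have top: "a = \<one>" if "\<one> \<preceq> a" "a \<in> carrier A" for a
    using that le_antisym le_unity unity_closed by blast
  show one: "x \<rightarrow> \<one> = \<one>" "x \<leadsto> \<one> = \<one>" "x \<rightarrow> x = \<one>" "x \<leadsto> x = \<one>"
    if "x \<in> carrier A" for x
    using that by (simp_all add: le_unity le_refl flip: le_iff_arr le_iff_sqarr)
  show "\<one> \<rightarrow> x = x" if x: "x \<in> carrier A" for x
  proof (rule le_antisym)
    have "(\<one> \<rightarrow> x) \<leadsto> x = \<one>"
      using le_arr_sqarr[of \<one> x] x by (intro top) auto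
    then show "\<one> \<rightarrow> x \<preceq> x" using x by (simp add: le_iff_sqarr)
    show "x \<preceq> \<one> \<rightarrow> x" using le_sqarr_arr[of x x] one x by simp
  qed (use x in auto)
  show "\<one> \<leadsto> x = x" if x: "x \<in> carrier A" for x
  proof (rule le_antisym)
    have "(\<one> \<leadsto> x) \<rightarrow> x = \<one>"
      using le_sqarr_arr[of \<one> x] x by (intro top) auto
    then show "\<one> \<leadsto> x \<preceq> x" using x by (simp add: le_iff_arr)
    show "x \<preceq> \<one> \<leadsto> x" using le_arr_sqarr[of x x] one x by simp
  qed (use x in auto)
qed

lemma unity_le_iff [simp]: "x \<in> carrier A \<Longrightarrow> \<one> \<preceq> x \<longleftrightarrow> x = \<one>"
  by (simp add: le_iff_arr)

lemma le_trans:
  assumes "x \<preceq> y" "y \<preceq> z" "x \<in> carrier A" "y \<in> carrier A" "z \<in> carrier A"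
  shows "x \<preceq> z"
proof -
  have "x \<rightarrow> y = \<one>" "y \<rightarrow> z = \<one>"
    using assms by (simp_all add: le_iff_arr)
  then show ?thesis
    using arr_trans[of x y z] assms by (simp add: le_iff_arr)
qed

lemma arr_antimono:
  assumes "x \<preceq> y" "x \<in> carrier A" "y \<in> carrier A" "z \<in> carrier A"
  shows "y \<rightarrow> z \<preceq> x \<rightarrow> z"
  using assms arr_trans[of x y z] by (simp add: le_iff_arr[of x] flip: le_iff_sqarr)

lemma sqarr_antimono:
  assumes "x \<preceq> y" "x \<in> carrier A" "y \<in> carrier A" "z \<in> carrier A"
  shows "y \<leadsto> z \<preceq> x \<leadsto> z"
  using assms sqarr_trans[of x y z] by (simp add: le_iff_sqarr[of x] flip: le_iff_arr)

text \<open>An arrow into \<open>z\<close> is antitone, so applying one to the hypothesis gives a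
  chain such as \<open>y \<preceq> (y \<rightarrow> z) \<leadsto> z \<preceq> x \<leadsto>
  z\<close>, whose first inequality is an axiom.\<close>

lemma residuation:
  assumes x: "x \<in> carrier A" and y: "y \<in> carrier A" and z: "z \<in> carrier A"
  shows "x \<preceq> y \<rightarrow> z \<longleftrightarrow> y \<preceq> x \<leadsto> z"
proof
  assume "x \<preceq> y \<rightarrow> z"
  then have "(y \<rightarrow> z) \<leadsto> z \<preceq> x \<leadsto> z"
    using assms by (intro sqarr_antimono) auto
  with le_arr_sqarr[OF y z] show "y \<preceq> x \<leadsto> z"
    using assms by (blast intro: le_trans)
next
  assume "y \<preceq> x \<leadsto> z"
  then have "(x \<leadsto> z) \<rightarrow> z \<preceq> y \<rightarrow> z"
    using assms by (intro arr_antimono) auto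
  with le_sqarr_arr[OF x z] show "x \<preceq> y \<rightarrow> z"
    using assms by (blast intro: le_trans)
qed

text \<open>Residuation swaps \<open>x \<rightarrow> y\<close> and \<open>y \<rightarrow> z\<close>
  in \<open>arr_trans\<close>. This form handles a change of the right argument of an arrow modulo a
  filter.\<close>

lemma arr_trans':
  assumes "x \<in> carrier A" "y \<in> carrier A" "z \<in> carrier A"
  shows "y \<rightarrow> z \<preceq> (x \<rightarrow> y) \<rightarrow> (x \<rightarrow> z)"
  using assms arr_trans[of x y z] by (simp add: residuation)

lemma sqarr_trans':
  assumes "x \<in> carrier A" "y \<in> carrier A" "z \<in> carrier A"
  shows "y \<leadsto> z \<preceq> (x \<leadsto> y) \<leadsto> (x \<leadsto> z)"
  using assms sqarr_trans[of x y z] by (simp add: residuation)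

lemma le_arr: "x \<in> carrier A \<Longrightarrow> y \<in> carrier A \<Longrightarrow> x \<preceq> y \<rightarrow> x"
  by (simp add: residuation le_unity)

lemma le_vee1_left: "x \<in> carrier A \<Longrightarrow> y \<in> carrier A \<Longrightarrow> x \<preceq> vee1 A x y"
  by (simp add: vee1_def le_arr_sqarr)

lemma le_vee1_right: "x \<in> carrier A \<Longrightarrow> y \<in> carrier A \<Longrightarrow> y \<preceq> vee1 A x y"
  by (simp add: vee1_def residuation[symmetric] le_unity)

lemma le_vee2_left: "x \<in> carrier A \<Longrightarrow> y \<in> carrier A \<Longrightarrow> x \<preceq> vee2 A x y"
  by (simp add: vee2_def le_sqarr_arr)

lemma le_vee2_right: "x \<in> carrier A \<Longrightarrow> y \<in> carrier A \<Longrightarrow> y \<preceq> vee2 A x y"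
  by (simp add: vee2_def le_arr)

lemma vee1_mono:
  assumes "x \<preceq> y" "x \<in> carrier A" "y \<in> carrier A" "z \<in> carrier A"
  shows "vee1 A x z \<preceq> vee1 A y z"
  using assms by (simp add: vee1_def arr_antimono sqarr_antimono)

lemma vee1_arr:
  assumes "x \<in> carrier A" "y \<in> carrier A"
  shows "vee1 A x y \<rightarrow> y = x \<rightarrow> y"
proof (rule le_antisym)
  show "vee1 A x y \<rightarrow> y \<preceq> x \<rightarrow> y"
    using assms by (intro arr_antimono le_vee1_left) auto
  \<comment> \<open>This is the axiom \<open>le_sqarr_arr\<close> with
    \<open>x \<rightarrow> y\<close> in the place of \<open>x\<close>.\<close>
  show "x \<rightarrow> y \<preceq> vee1 A x y \<rightarrow> y"
    using assms by (simp add: vee1_def le_sqarr_arr)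
qed (use assms in auto)

end

section \<open>Quotients by normal filters\<close>

locale psbck_filter = psbck +
  fixes F
  assumes normal: "normal_filter A F"
begin

lemma filter_closed: "x \<in> F \<Longrightarrow> x \<in> carrier A"
  and filter_unity [simp]: "\<one> \<in> F"
  and filter_mp: "x \<in> F \<Longrightarrow> x \<rightarrow> y \<in> F \<Longrightarrow> y \<in> carrier A \<Longrightarrow> y \<in> F"
  and sqarr_in_iff: "x \<in> carrier A \<Longrightarrow> y \<in> carrier A \<Longrightarrow> x \<leadsto> y \<in> F \<longleftrightarrow> x \<rightarrow> y \<in> F"
  using normal unfolding normal_filter_def bck_filter_def by blast+

lemma filter_up: "x \<in> F \<Longrightarrow> x \<preceq> y \<Longrightarrow> y \<in> carrier A \<Longrightarrow> y \<in> F"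
  using filter_mp[of x y] filter_closed[of x] by (simp add: le_iff_arr)

lemma arr_in_trans:
  assumes "x \<rightarrow> y \<in> F" "y \<rightarrow> z \<in> F" "x \<in> carrier A" "y \<in> carrier A" "z \<in> carrier A"
  shows "x \<rightarrow> z \<in> F"
proof -
  have "(y \<rightarrow> z) \<leadsto> (x \<rightarrow> z) \<in> F"
    using assms by (intro filter_up[OF _ arr_trans]) auto
  then show ?thesis
    using assms filter_mp[of "y \<rightarrow> z" "x \<rightarrow> z"] by (simp add: sqarr_in_iff)
qed

lemma theta_iff:
  "(x, y) \<in> theta A F \<longleftrightarrow> x \<in> carrier A \<and> y \<in> carrier A \<and> x \<rightarrow> y \<in> F \<and> y \<rightarrow> x \<in> F"
  by (simp add: theta_def)

lemma trans_theta: "trans (theta A F)"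
proof (rule transI)
  fix x y z
  assume "(x, y) \<in> theta A F" "(y, z) \<in> theta A F"
  then show "(x, z) \<in> theta A F"
    using arr_in_trans[of x y z] arr_in_trans[of z y x] by (simp add: theta_iff)
qed

lemma equiv_theta: "equiv (carrier A) (theta A F)"
  using trans_theta by (intro equivI refl_onI symI) (auto simp: theta_iff)

text \<open>The right-hand side of \<open>arr_trans\<close> lies above
  \<open>x \<rightarrow> y\<close>, hence in \<open>F\<close>; normality then turns its outer
  \<open>\<leadsto>\<close> into \<open>\<rightarrow>\<close>. The next three lemmas are the
  analogues for the other argument and the other arrow.\<close>

lemma arr_left_in:
  assumes "x \<rightarrow> y \<in> F" "x \<in> carrier A" "y \<in> carrier A" "z \<in> carrier A"
  shows "(y \<rightarrow> z) \<rightarrow> (x \<rightarrow> z) \<in> F"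
  using filter_up[OF _ arr_trans[of x y z]] assms by (simp add: sqarr_in_iff)

lemma arr_right_in:
  assumes "x \<rightarrow> y \<in> F" "x \<in> carrier A" "y \<in> carrier A" "z \<in> carrier A"
  shows "(z \<rightarrow> x) \<rightarrow> (z \<rightarrow> y) \<in> F"
  using filter_up[OF _ arr_trans'[of z x y]] assms by simp

lemma sqarr_left_in:
  assumes "x \<rightarrow> y \<in> F" "x \<in> carrier A" "y \<in> carrier A" "z \<in> carrier A"
  shows "(y \<leadsto> z) \<rightarrow> (x \<leadsto> z) \<in> F"
  using filter_up[OF _ sqarr_trans[of x y z]] assms by (simp add: sqarr_in_iff)

lemma sqarr_right_in:
  assumes "x \<rightarrow> y \<in> F" "x \<in> carrier A" "y \<in> carrier A" "z \<in> carrier A"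
  shows "(z \<leadsto> x) \<rightarrow> (z \<leadsto> y) \<in> F"
  using filter_up[OF _ sqarr_trans'[of z x y]] assms by (simp add: sqarr_in_iff)

lemma theta_arr:
  assumes "(a, b) \<in> theta A F" "(c, d) \<in> theta A F"
  shows "(a \<rightarrow> c, b \<rightarrow> d) \<in> theta A F"
proof -
  \<comment> \<open>One argument is changed at a time, passing through
    \<open>b \<rightarrow> c\<close>.\<close>
  have "(a \<rightarrow> c, b \<rightarrow> c) \<in> theta A F" "(b \<rightarrow> c, b \<rightarrow> d) \<in> theta A F"
    using assms by (auto simp: theta_iff arr_left_in arr_right_in)
  then show ?thesis
    by (rule transD[OF trans_theta])
qed

lemma theta_sqarr:
  assumes "(a, b) \<in> theta A F" "(c, d) \<in> theta A F"
  shows "(a \<leadsto> c, b \<leadsto> d) \<in> theta A F"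
proof -
  have "(a \<leadsto> c, b \<leadsto> c) \<in> theta A F" "(b \<leadsto> c, b \<leadsto> d) \<in> theta A F"
    using assms by (auto simp: theta_iff sqarr_left_in sqarr_right_in)
  then show ?thesis
    by (rule transD[OF trans_theta])
qed

lemma bck_congruence_theta: "bck_congruence A (theta A F)"
  using equiv_theta theta_arr theta_sqarr by (simp add: bck_congruence_def)

lemma cls_eq_iff:
  "x \<in> carrier A \<Longrightarrow> y \<in> carrier A \<Longrightarrow> cls A F x = cls A F y \<longleftrightarrow> x \<rightarrow> y \<in> F \<and> y \<rightarrow> x \<in> F"
  unfolding cls_def using eq_equiv_class_iff[OF equiv_theta] by (simp add: theta_iff)

lemma mem_cls_iff: "y \<in> cls A F x \<longleftrightarrow> (x, y) \<in> theta A F"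
  by (simp add: cls_def)

lemma cls_self: "x \<in> carrier A \<Longrightarrow> x \<in> cls A F x"
  by (simp add: mem_cls_iff theta_iff)

lemma cls_cong: "(x, y) \<in> theta A F \<Longrightarrow> cls A F x = cls A F y"
  unfolding cls_def by (rule equiv_class_eq[OF equiv_theta])

lemma carrier_quot: "carrier (quot A F) = cls A F ` carrier A"
  by (auto simp: quot_def quotient_def cls_def)

lemma quot_arr:
  assumes "x \<in> carrier A" "y \<in> carrier A"
  shows "cls A F x \<rightarrow>\<^bsub>quot A F\<^esub> cls A F y = cls A F (x \<rightarrow> y)"
proof -
  have "cls A F (x' \<rightarrow> y') = cls A F (x \<rightarrow> y)" if "x' \<in> cls A F x" "y' \<in> cls A F y" for x' y'
    using that by (metis cls_cong mem_cls_iff theta_arr)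
  then have "cls A F x \<rightarrow>\<^bsub>quot A F\<^esub> cls A F y = (\<Union>_\<in>cls A F x. \<Union>_\<in>cls A F y. cls A F (x \<rightarrow> y))"
    by (simp add: quot_def cong: SUP_cong)
  \<comment> \<open>The union of copies of one class is that class because both index sets are
    nonempty.\<close>
  also have "\<dots> = cls A F (x \<rightarrow> y)"
    using cls_self assms by blast
  finally show ?thesis .
qed

lemma quot_sqarr:
  assumes "x \<in> carrier A" "y \<in> carrier A"
  shows "cls A F x \<leadsto>\<^bsub>quot A F\<^esub> cls A F y = cls A F (x \<leadsto> y)"
proof -
  have "cls A F (x' \<leadsto> y') = cls A F (x \<leadsto> y)" if "x' \<in> cls A F x" "y' \<in> cls A F y" for x' y'
    using that by (metis cls_cong mem_cls_iff theta_sqarr)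
  then have "cls A F x \<leadsto>\<^bsub>quot A F\<^esub> cls A F y = (\<Union>_\<in>cls A F x. \<Union>_\<in>cls A F y. cls A F (x \<leadsto> y))"
    by (simp add: quot_def cong: SUP_cong)
  also have "\<dots> = cls A F (x \<leadsto> y)"
    using cls_self assms by blast
  finally show ?thesis .
qed

lemma quot_leq:
  assumes "x \<in> carrier A" "y \<in> carrier A"
  shows "cls A F x \<preceq>\<^bsub>quot A F\<^esub> cls A F y \<longleftrightarrow> x \<rightarrow> y \<in> F"
proof -
  \<comment> \<open>Independence of representatives: the arrows compose along \<open>x\<close>,
    \<open>x'\<close>, \<open>y'\<close>, \<open>y\<close>.\<close>
  have "x \<rightarrow> y \<in> F" if "x' \<in> cls A F x" "y' \<in> cls A F y" "x' \<rightarrow> y' \<in> F" for x' y'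
  proof -
    from that have "x \<rightarrow> x' \<in> F" "x' \<in> carrier A" "y' \<in> carrier A" "y' \<rightarrow> y \<in> F"
      by (auto simp: mem_cls_iff theta_iff)
    with that(3) assms show ?thesis by (meson arr_in_trans)
  qed
  then show ?thesis
    using cls_self assms unfolding quot_def psbck.simps by blast
qed

lemma quot_unity: "\<one>\<^bsub>quot A F\<^esub> = cls A F \<one>"
  by (simp add: quot_def)

lemma cls_eq_unity_iff: "x \<in> carrier A \<Longrightarrow> cls A F x = cls A F \<one> \<longleftrightarrow> x \<in> F"
  by (simp add: cls_eq_iff)

lemma pseudo_bck_quot: "pseudo_bck (quot A F)"
proof -
  have le: "x \<rightarrow> y \<in> F" if "x \<preceq> y" "x \<in> carrier A" "y \<in> carrier A" for x y
    using that by (simp add: le_iff_arr)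
  show ?thesis
    by unfold_locales
      (auto simp: carrier_quot quot_arr quot_sqarr quot_leq quot_unity cls_eq_unity_iff
        sqarr_in_iff cls_eq_iff
        intro!: le[OF arr_trans] le[OF sqarr_trans] le[OF le_arr_sqarr] le[OF le_sqarr_arr]
        \<comment> \<open>Without \<open>equalityI\<close>, equations between classes are not split
          into inclusions, so \<open>cls_eq_iff\<close> can rewrite them.\<close>
        del: equalityI)
qed

end

section \<open>Measures and their values on joins\<close>

locale psbck_measure = psbck +
  fixes m
  assumes measure: "bck_measure A m"
begin

lemma measure_nonneg: "x \<in> carrier A \<Longrightarrow> 0 \<le> m x"
  and measure_arr: "x \<in> carrier A \<Longrightarrow> y \<in> carrier A \<Longrightarrow> y \<preceq> x \<Longrightarrow> m (x \<rightarrow> y) = m y - m x"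
  and measure_sqarr: "x \<in> carrier A \<Longrightarrow> y \<in> carrier A \<Longrightarrow> y \<preceq> x \<Longrightarrow> m (x \<leadsto> y) = m y - m x"
  using measure by (auto simp: bck_measure_def)

lemma measure_unity [simp]: "m \<one> = 0"
  using measure_arr[of \<one> \<one>] le_refl by simp

lemma measure_antimono:
  assumes "x \<preceq> y" "x \<in> carrier A" "y \<in> carrier A"
  shows "m y \<le> m x"
  using measure_arr[of y x] measure_nonneg[of "y \<rightarrow> x"] assms by simp

lemma measure_arr_vee1:
  assumes "x \<in> carrier A" "y \<in> carrier A"
  shows "m (x \<rightarrow> y) = m y - m (vee1 A x y)"
  using measure_arr[of "vee1 A x y" y] assms by (simp add: le_vee1_right vee1_arr)

text \<open>Since \<open>x \<preceq> y \<rightarrow> x\<close>, the measure law applies to both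
  arrows of \<open>(y \<rightarrow> x) \<leadsto> x\<close> and gives
  \<open>m x - (m x - m y)\<close>.\<close>

lemma measure_vee1_of_le:
  assumes "x \<preceq> y" "x \<in> carrier A" "y \<in> carrier A"
  shows "m (vee1 A y x) = m y"
  using assms measure_arr[of y x] measure_sqarr[of "y \<rightarrow> x" x] by (simp add: vee1_def le_arr)

lemma measure_vee1_commute:
  assumes "x \<in> carrier A" "y \<in> carrier A"
  shows "m (vee1 A x y) = m (vee1 A y x)"
proof -
  have "m (vee1 A x y) \<le> m (vee1 A y x)" if "x \<in> carrier A" "y \<in> carrier A" for x y
    \<comment> \<open>With \<open>z = vee1 A x y\<close>, monotonicity gives
      \<open>vee1 A y x \<preceq> vee1 A z x\<close>, and \<open>m (vee1 A z x) = m z\<close>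
      because \<open>x \<preceq> z\<close>.\<close>
    using measure_antimono[OF vee1_mono[OF le_vee1_right[OF that], of x]]
      measure_vee1_of_le[OF le_vee1_left[OF that]] that by simp
  from this[of x y] this[of y x] show ?thesis
    using assms by simp
qed

text \<open>The same comparison with \<open>z = vee2 A x y\<close>:
  \<open>vee1 A x y \<preceq> vee1 A z y\<close>, while \<open>m (vee1 A z y) = m z\<close>.\<close>

lemma measure_vee2_le_vee1:
  assumes "x \<in> carrier A" "y \<in> carrier A"
  shows "m (vee2 A x y) \<le> m (vee1 A x y)"
  using measure_antimono[OF vee1_mono[OF le_vee2_left[OF assms], of y]]
    measure_vee1_of_le[OF le_vee2_right[OF assms]] assms by simp

text \<open>Faithfulness makes comparable elements of equal measure coincide, so
  \<open>absorb\<close> sharpens \<open>measure_vee1_of_le\<close> to an equality of elements. It is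
  meant for the quotient and its dual.\<close>

lemma vee1_commutative_of_faithful:
  assumes faithful: "\<And>x. x \<in> carrier A \<Longrightarrow> m x = 0 \<Longrightarrow> x = \<one>"
  shows "vee1_commutative A"
proof -
  have absorb: "vee1 A z x = z" if "x \<preceq> z" "x \<in> carrier A" "z \<in> carrier A" for x z
  proof (rule le_antisym)
    have "m (vee1 A z x \<rightarrow> z) = 0"
      using that by (simp add: measure_arr le_vee1_left measure_vee1_of_le)
    then show "vee1 A z x \<preceq> z"
      using that faithful by (simp add: le_iff_arr)
  qed (use that in \<open>auto intro: le_vee1_left\<close>)
  have "vee1 A y x \<preceq> vee1 A x y" if "x \<in> carrier A" "y \<in> carrier A" for x y
    using vee1_mono[OF le_vee1_right[OF that], of x] absorb[OF le_vee1_left[OF that]] that by simp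
  then show ?thesis
    unfolding vee1_commutative_def by (auto intro: le_antisym)
qed

end

lemma psbck_measure_dual:
  assumes "psbck_measure A m"
  shows "psbck_measure (dual A) m"
proof -
  interpret psbck_measure A m by fact
  show ?thesis
    using pseudo_bck_dual[OF pseudo_bck_axioms] measure
    by (simp add: psbck_measure_def psbck_measure_axioms_def psbck_def)
qed

section \<open>The kernel and its quotient\<close>

context psbck_measure
begin

lemma measure_vee2_eq_vee1:
  assumes "x \<in> carrier A" "y \<in> carrier A"
  shows "m (vee2 A x y) = m (vee1 A x y)"
proof -
  \<comment> \<open>In the dual algebra \<open>vee1\<close> and \<open>vee2\<close> trade places,
    which supplies the reverse inequality.\<close>
  interpret d: psbck_measure "dual A" m
    by (rule psbck_measure_dual) unfold_locales
  show ?thesis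
    using measure_vee2_le_vee1[of x y] d.measure_vee2_le_vee1[of x y] assms by simp
qed

lemma measure_sqarr_eq_arr:
  assumes "x \<in> carrier A" "y \<in> carrier A"
  shows "m (x \<leadsto> y) = m (x \<rightarrow> y)"
proof -
  interpret d: psbck_measure "dual A" m
    by (rule psbck_measure_dual) unfold_locales
  show ?thesis
    using measure_arr_vee1[of x y] d.measure_arr_vee1[of x y] measure_vee2_eq_vee1 assms by simp
qed

lemma normal_filter_ker0: "normal_filter A (ker0 A m)"
proof -
  \<comment> \<open>From \<open>a \<preceq> vee1 A a b\<close> and \<open>m a = 0\<close> follows
    \<open>m (vee1 A a b) = 0\<close>, so \<open>m (a \<rightarrow> b) = m b\<close>.\<close>
  have "m b = 0" if "a \<in> carrier A" "b \<in> carrier A" "m a = 0" "m (a \<rightarrow> b) = 0" for a b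
    using that measure_arr_vee1[of a b] measure_antimono[OF le_vee1_left[of a b]]
      measure_nonneg[of "vee1 A a b"] by simp
  then have "bck_filter A (ker0 A m)"
    unfolding bck_filter_def ker0_def using unity_closed measure_unity by blast
  then show ?thesis
    by (simp add: normal_filter_def ker0_def measure_sqarr_eq_arr)
qed

sublocale psbck_filter A "ker0 A m"
  by unfold_locales (rule normal_filter_ker0)

lemma measure_theta: "(x, y) \<in> theta A (ker0 A m) \<Longrightarrow> m x = m y"
  \<comment> \<open>The order matters: \<open>theta_iff\<close> is stated here for
    \<open>ker0 A m\<close> and would no longer match once \<open>ker0\<close> is unfolded.\<close>
  unfolding theta_iff unfolding ker0_def
  using measure_arr_vee1[of x y] measure_arr_vee1[of y x] measure_vee1_commute[of x y] by simp

lemma measure_respects_theta: "m respects theta A (ker0 A m)"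
  by (rule congruentI) (rule measure_theta)

lemma quot_measure_cls:
  assumes "x \<in> carrier A"
  shows "quot_measure m (cls A (ker0 A m) x) = m x"
  unfolding quot_measure_def
proof (rule the_elem_image_unique)
  show "cls A (ker0 A m) x \<noteq> {}"
    using cls_self[OF assms] by blast
  show "m y = m x" if "y \<in> cls A (ker0 A m) x" for y
    using that measure_theta[of x y] by (simp add: mem_cls_iff)
qed

text \<open>The measure law with \<open>y \<preceq> x\<close> weakened to the order of the quotient:
  \<open>m (y \<rightarrow> x) = 0\<close> means \<open>m (vee1 A y x) = m x\<close>, and symmetry
  of the join's measure does the rest.\<close>

lemma measure_arr_of_arr_ker0:
  assumes "x \<in> carrier A" "y \<in> carrier A" "y \<rightarrow> x \<in> ker0 A m"
  shows "m (x \<rightarrow> y) = m y - m x"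
  using assms measure_arr_vee1[of x y] measure_arr_vee1[of y x] measure_vee1_commute[of x y]
  by (simp add: ker0_def)

lemma bck_measure_quot: "bck_measure (quot A (ker0 A m)) (quot_measure m)"
  by (auto simp: bck_measure_def carrier_quot quot_leq quot_arr quot_sqarr quot_measure_cls
      measure_sqarr_eq_arr measure_arr_of_arr_ker0 measure_nonneg)

text \<open>A class of measure zero has its representatives in the kernel, which is the class of the
  unit. This is the hypothesis of \<open>vee1_commutative_of_faithful\<close>.\<close>

lemma quot_faithful:
  assumes "X \<in> carrier (quot A (ker0 A m))" "quot_measure m X = 0"
  shows "X = \<one>\<^bsub>quot A (ker0 A m)\<^esub>"
proof -
  obtain x where x: "x \<in> carrier A" "X = cls A (ker0 A m) x"
    using assms(1) by (auto simp: carrier_quot)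
  then have "x \<in> ker0 A m"
    using assms(2) by (simp add: quot_measure_cls) (simp add: ker0_def)
  then show ?thesis
    using x by (simp add: quot_unity cls_eq_unity_iff)
qed

lemma vee_commutative_quot:
  "vee1_commutative (quot A (ker0 A m))" "vee2_commutative (quot A (ker0 A m))"
proof -
  let ?Q = "quot A (ker0 A m)"
  interpret q: psbck_measure ?Q "quot_measure m"
    using pseudo_bck_quot bck_measure_quot
    by (simp add: psbck_measure_def psbck_measure_axioms_def psbck_def)
  interpret qd: psbck_measure "dual ?Q" "quot_measure m"
    by (rule psbck_measure_dual) unfold_locales
  show "vee1_commutative ?Q"
    by (rule q.vee1_commutative_of_faithful) (rule quot_faithful)
  \<comment> \<open>The dual of the quotient has the same carrier and unit, so faithfulness carries
    over unchanged.\<close>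
  have "vee1_commutative (dual ?Q)"
    by (rule qd.vee1_commutative_of_faithful) (use quot_faithful in simp)
  then show "vee2_commutative ?Q"
    by (simp add: vee1_commutative_def vee2_commutative_def)
qed

end

theorem theorem4p8:
  fixes A :: "('a, 'b) psbck_scheme" and m :: "'a \<Rightarrow> real"
  assumes "pseudo_bck A"
    and "bck_measure A m"
  shows "let K = ker0 A m; Q = quot A K; mhat = quot_measure m in
    normal_filter A K \<and>
    bck_congruence A (theta A K) \<and>
    (\<forall>x\<in>carrier A. \<forall>y\<in>carrier A.
      cls A K x \<rightarrow>\<^bsub>Q\<^esub> cls A K y = cls A K (x \<rightarrow>\<^bsub>A\<^esub> y) \<and>
      cls A K x \<leadsto>\<^bsub>Q\<^esub> cls A K y = cls A K (x \<leadsto>\<^bsub>A\<^esub> y) \<and>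
      (cls A K x \<preceq>\<^bsub>Q\<^esub> cls A K y \<longleftrightarrow> x \<rightarrow>\<^bsub>A\<^esub> y \<in> K)) \<and>
    pseudo_bck Q \<and>
    m respects theta A K \<and>
    (\<forall>x\<in>carrier A. mhat (cls A K x) = m x) \<and>
    bck_measure Q mhat \<and>
    vee1_commutative Q \<and>
    vee2_commutative Q"
  proof -
  interpret psbck_measure A m
    using assms by (simp add: psbck_measure_def psbck_measure_axioms_def psbck_def)
  show ?thesis
    unfolding Let_def
    using normal_filter_ker0 bck_congruence_theta pseudo_bck_quot bck_measure_quot
      vee_commutative_quot measure_respects_theta
    by (simp add: quot_arr quot_sqarr quot_leq quot_measure_cls)
qed

end
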